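(* Provably in Mac~Lane Type Theory: for any set $A$ and class $\mathcal{B}$, the set theoretic formula (in the variable $f$) "there is a set $B\subseteq^0\mathcal{B}$ such that $f$ is a function $f\colon A\to B$" defines a class $\mathcal{B}^A$, and this class consists exactly of all bounded class functions from the class $\{x\mid x\in A\}^1$ to $\mathcal{B}$.
   Context: Mac~Lane Type Theory (MTT) has sets, classes and collections; sets satisfy \textsf{MAC}+V=L (ZFC without replacement, with only bounded separation, with transitive containment and V=L). $x\in^1\mathcal{A}$ means set $x$ is in class $\mathcal{A}$; classes are defined by formulas quantifying only over sets. A set $A$ is a subset of class $\mathcal{A}$, written $A\subseteq^0\mathcal{A}$, if every $x\in A$ satisfies $x\in^1\mathcal{A}$. A class function $f\colon\mathcal{A}\to\mathcal{B}$ is a class $\Gamma_f\subseteq^1\mathcal{A}\times\mathcal{B}$ that is single-valued and total on $\mathcal{A}$; it is bounded if every $A\subseteq^0\mathcal{A}$ has a set image $f(A)\subseteq^0\mathcal{B}$ such that the graph of $f|_A$ is a subset (a set) of $A\times f(A)$. *)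

theory Defs
  imports Main
begin

text \<open>
  Mac Lane Type Theory (MTT) as a first-order theory with three types of variables, together with
  a natural deduction calculus for classical logic with equality, so that ``provable in MTT'' is
  literally derivability.

  Variables are de Bruijn indices, with a separate index space for each type: a quantifier over
  one type leaves the indices of the other types alone.  The members of a set and of a class are
  sets, those of a collection are classes.
\<close>

datatype mtype = Sets | Classes | Collections

fun elt :: "mtype \<Rightarrow> mtype" where
  "elt Sets = Sets"
| "elt Classes = Sets"
| "elt Collections = Classes"

text \<open>In \<open>Mem t i j\<close> the variable \<open>j\<close> has type \<open>t\<close> and \<open>i\<close> has type \<open>elt t\<close>.\<close>

datatype fm =
    Falsum
  | Eq mtype nat nat
  | Mem mtype nat nat
  | Imp fm fm  (infixr "\<^bold>\<longrightarrow>" 25)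
  | Forall mtype fm

abbreviation Neg :: "fm \<Rightarrow> fm"  ("\<^bold>\<not> _" [40] 40)
  where "\<^bold>\<not> \<phi> \<equiv> \<phi> \<^bold>\<longrightarrow> Falsum"
abbreviation Con :: "fm \<Rightarrow> fm \<Rightarrow> fm"  (infixr "\<^bold>\<and>" 35)
  where "\<phi> \<^bold>\<and> \<psi> \<equiv> \<^bold>\<not> (\<phi> \<^bold>\<longrightarrow> \<^bold>\<not> \<psi>)"
abbreviation Dis :: "fm \<Rightarrow> fm \<Rightarrow> fm"  (infixr "\<^bold>\<or>" 30)
  where "\<phi> \<^bold>\<or> \<psi> \<equiv> \<^bold>\<not> \<phi> \<^bold>\<longrightarrow> \<psi>"
abbreviation Iff :: "fm \<Rightarrow> fm \<Rightarrow> fm"  (infix "\<^bold>\<longleftrightarrow>" 26)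
  where "\<phi> \<^bold>\<longleftrightarrow> \<psi> \<equiv> (\<phi> \<^bold>\<longrightarrow> \<psi>) \<^bold>\<and> (\<psi> \<^bold>\<longrightarrow> \<phi>)"
abbreviation Exists :: "mtype \<Rightarrow> fm \<Rightarrow> fm"
  where "Exists t \<phi> \<equiv> \<^bold>\<not> Forall t (\<^bold>\<not> \<phi>)"

abbreviation eq0 :: "nat \<Rightarrow> nat \<Rightarrow> fm"  (infix "\<^bold>=" 50)
  where "i \<^bold>= j \<equiv> Eq Sets i j"
abbreviation mem0 :: "nat \<Rightarrow> nat \<Rightarrow> fm"  (infix "\<in>\<^sup>0" 50)
  where "i \<in>\<^sup>0 j \<equiv> Mem Sets i j"
abbreviation mem1 :: "nat \<Rightarrow> nat \<Rightarrow> fm"  (infix "\<in>\<^sup>1" 50)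
  where "i \<in>\<^sup>1 j \<equiv> Mem Classes i j"

text \<open>Bounded quantifiers; in \<open>\<phi>\<close> the bounded variable is the set variable 0.\<close>

abbreviation BAll :: "nat \<Rightarrow> fm \<Rightarrow> fm"
  where "BAll a \<phi> \<equiv> Forall Sets (0 \<in>\<^sup>0 Suc a \<^bold>\<longrightarrow> \<phi>)"
abbreviation BEx :: "nat \<Rightarrow> fm \<Rightarrow> fm"
  where "BEx a \<phi> \<equiv> \<^bold>\<not> BAll a (\<^bold>\<not> \<phi>)"


section \<open>Derivability\<close>

text \<open>Since the terms are just variables, substitution is renaming of variables.\<close>

definition up :: "mtype \<Rightarrow> (mtype \<Rightarrow> nat \<Rightarrow> nat) \<Rightarrow> mtype \<Rightarrow> nat \<Rightarrow> nat" where
  "up t \<rho> = (\<lambda>s n. if s = t then (case n of 0 \<Rightarrow> 0 | Suc m \<Rightarrow> Suc (\<rho> s m)) else \<rho> s n)"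

primrec ren :: "(mtype \<Rightarrow> nat \<Rightarrow> nat) \<Rightarrow> fm \<Rightarrow> fm" where
  "ren \<rho> Falsum = Falsum"
| "ren \<rho> (Eq t i j) = Eq t (\<rho> t i) (\<rho> t j)"
| "ren \<rho> (Mem t i j) = Mem t (\<rho> (elt t) i) (\<rho> t j)"
| "ren \<rho> (\<phi> \<^bold>\<longrightarrow> \<psi>) = (ren \<rho> \<phi> \<^bold>\<longrightarrow> ren \<rho> \<psi>)"
| "ren \<rho> (Forall t \<phi>) = Forall t (ren (up t \<rho>) \<phi>)"

definition shift :: "mtype \<Rightarrow> mtype \<Rightarrow> nat \<Rightarrow> nat" where
  "shift t = (\<lambda>s n. if s = t then Suc n else n)"

definition inst :: "mtype \<Rightarrow> nat \<Rightarrow> fm \<Rightarrow> fm" where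
  "inst t k \<phi> = ren (\<lambda>s n. if s = t then (case n of 0 \<Rightarrow> k | Suc m \<Rightarrow> m) else n) \<phi>"

text \<open>
  Axioms with free variables stand for their universal closures: in the rule \<open>AllI\<close> the eigenvariable
  condition only concerns the local hypotheses \<open>\<Gamma>\<close>.
\<close>

inductive derivable :: "fm set \<Rightarrow> fm list \<Rightarrow> fm \<Rightarrow> bool" for T :: "fm set" where
  Axiom: "\<phi> \<in> T \<Longrightarrow> derivable T \<Gamma> \<phi>"
| Assm: "\<phi> \<in> set \<Gamma> \<Longrightarrow> derivable T \<Gamma> \<phi>"
| ImpI: "derivable T (\<phi> # \<Gamma>) \<psi> \<Longrightarrow> derivable T \<Gamma> (\<phi> \<^bold>\<longrightarrow> \<psi>)"
| ImpE: "derivable T \<Gamma> (\<phi> \<^bold>\<longrightarrow> \<psi>) \<Longrightarrow> derivable T \<Gamma> \<phi> \<Longrightarrow> derivable T \<Gamma> \<psi>"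
| Classical: "derivable T ((\<^bold>\<not> \<phi>) # \<Gamma>) Falsum \<Longrightarrow> derivable T \<Gamma> \<phi>"
| AllI: "derivable T (map (ren (shift t)) \<Gamma>) \<phi> \<Longrightarrow> derivable T \<Gamma> (Forall t \<phi>)"
| AllE: "derivable T \<Gamma> (Forall t \<phi>) \<Longrightarrow> derivable T \<Gamma> (inst t k \<phi>)"
| EqRefl: "derivable T \<Gamma> (Eq t k k)"
| EqSubst: "derivable T \<Gamma> (Eq t k l) \<Longrightarrow> derivable T \<Gamma> (inst t k \<phi>) \<Longrightarrow> derivable T \<Gamma> (inst t l \<phi>)"

definition provable :: "fm set \<Rightarrow> fm \<Rightarrow> bool"  (infix "\<turnstile>" 20) where
  "(T \<turnstile> \<phi>) = derivable T [] \<phi>"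


section \<open>Set-theoretic vocabulary\<close>

text \<open>\<open>\<phi>\<close> quantifies only over sets; free variables of any type are allowed as parameters.\<close>

primrec quantifies_over_sets :: "fm \<Rightarrow> bool" where
  "quantifies_over_sets Falsum \<longleftrightarrow> True"
| "quantifies_over_sets (Eq t i j) \<longleftrightarrow> True"
| "quantifies_over_sets (Mem t i j) \<longleftrightarrow> True"
| "quantifies_over_sets (\<phi> \<^bold>\<longrightarrow> \<psi>) \<longleftrightarrow> quantifies_over_sets \<phi> \<and> quantifies_over_sets \<psi>"
| "quantifies_over_sets (Forall t \<phi>) \<longleftrightarrow> t = Sets \<and> quantifies_over_sets \<phi>"

text \<open>Bounded formulas of the language of sets, without class or collection parameters.\<close>

inductive bounded_fm :: "fm \<Rightarrow> bool" where
  "bounded_fm Falsum"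
| "bounded_fm (i \<^bold>= j)"
| "bounded_fm (i \<in>\<^sup>0 j)"
| "bounded_fm \<phi> \<Longrightarrow> bounded_fm \<psi> \<Longrightarrow> bounded_fm (\<phi> \<^bold>\<longrightarrow> \<psi>)"
| "bounded_fm \<phi> \<Longrightarrow> bounded_fm (BAll a \<phi>)"

text \<open>
  Names such as \<open>a\<close>, \<open>b\<close>, \<open>f\<close>, \<open>x\<close> below are indices of set variables and capital letters such as
  \<open>A\<close>, \<open>B\<close>, \<open>G\<close> are indices of class variables.  Under a quantifier over sets the former
  have to be shifted and the latter do not.
\<close>

definition Subset :: "nat \<Rightarrow> nat \<Rightarrow> fm" where
  "Subset a b = BAll a (0 \<in>\<^sup>0 b+1)"

definition Empty :: "nat \<Rightarrow> fm" where
  "Empty a = BAll a Falsum"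

definition Is_succ :: "nat \<Rightarrow> nat \<Rightarrow> fm" where  \<comment> \<open>\<open>y = x \<union> {x}\<close>\<close>
  "Is_succ y x = Forall Sets (0 \<in>\<^sup>0 y+1 \<^bold>\<longleftrightarrow> (0 \<in>\<^sup>0 x+1 \<^bold>\<or> 0 \<^bold>= x+1))"

definition Is_upair :: "nat \<Rightarrow> nat \<Rightarrow> nat \<Rightarrow> fm" where  \<comment> \<open>\<open>u = {x, y}\<close>\<close>
  "Is_upair u x y = (x \<in>\<^sup>0 u \<^bold>\<and> y \<in>\<^sup>0 u \<^bold>\<and> BAll u (0 \<^bold>= x+1 \<^bold>\<or> 0 \<^bold>= y+1))"

definition Is_pair :: "nat \<Rightarrow> nat \<Rightarrow> nat \<Rightarrow> fm" where  \<comment> \<open>\<open>p = {{x}, {x, y}}\<close>\<close>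
  "Is_pair p x y =
     BEx p (BEx (p+1) (Is_upair 1 (x+2) (x+2) \<^bold>\<and> Is_upair 0 (x+2) (y+2) \<^bold>\<and> Is_upair (p+2) 1 0))"

definition Pair_in :: "nat \<Rightarrow> nat \<Rightarrow> nat \<Rightarrow> fm" where  \<comment> \<open>\<open>\<langle>x, y\<rangle> \<in> f\<close>\<close>
  "Pair_in x y f = BEx f (Is_pair 0 (x+1) (y+1))"

definition Function :: "nat \<Rightarrow> nat \<Rightarrow> nat \<Rightarrow> fm" where  \<comment> \<open>the set \<open>f\<close> is a function from \<open>a\<close> to \<open>b\<close>\<close>
  "Function f a b =
     (BAll f (BEx (a+1) (BEx (b+2) (Is_pair 2 1 0)))
      \<^bold>\<and> BAll a (BEx (b+1) (Pair_in 1 0 (f+2)))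
      \<^bold>\<and> BAll a (BAll (b+1) (BAll (b+2) (Pair_in 2 1 (f+3) \<^bold>\<and> Pair_in 2 0 (f+3) \<^bold>\<longrightarrow> 1 \<^bold>= 0))))"

definition Transitive :: "nat \<Rightarrow> fm" where
  "Transitive a = BAll a (BAll 0 (0 \<in>\<^sup>0 a+2))"

definition Ordinal :: "nat \<Rightarrow> fm" where  \<comment> \<open>a transitive set of transitive sets (with Foundation)\<close>
  "Ordinal a = (Transitive a \<^bold>\<and> BAll a (Transitive 0))"

definition Is_omega :: "nat \<Rightarrow> fm" where  \<comment> \<open>an ordinal closed under successor, all of whose members are 0 or successors\<close>
  "Is_omega w =
     (Ordinal w \<^bold>\<and> BEx w (Empty 0) \<^bold>\<and> BAll w (BEx (w+1) (Is_succ 0 1))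
      \<^bold>\<and> BAll w (Empty 0 \<^bold>\<or> BEx (w+1) (Is_succ 1 0)))"


section \<open>The axiom V=L\<close>

text \<open>
  The first-order definable subsets of a set \<open>a\<close> are described by Tarski's inductive definition
  of satisfaction, with assignments \<open>s : \<omega> \<rightarrow> a\<close>: the relations of the form
  \<open>{s. (a, \<in>) satisfies \<psi>[s]}\<close> are those belonging to every set \<open>d\<close> that contains
  \<open>{s. s(i) \<in> s(j)}\<close> and \<open>{s. s(i) = s(j)}\<close> and is closed under complements, binary
  intersections and existential quantification of a coordinate.
\<close>

text \<open>\<open>s'\<close> is the assignment \<open>s(i := x)\<close> in \<open>w \<rightarrow> a\<close>.\<close>

definition Is_update :: "nat \<Rightarrow> nat \<Rightarrow> nat \<Rightarrow> nat \<Rightarrow> nat \<Rightarrow> nat \<Rightarrow> fm" where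
  "Is_update s' s i x w a =
     (Function s' w a \<^bold>\<and> Pair_in i x s'
      \<^bold>\<and> BAll w (\<^bold>\<not> (0 \<^bold>= i+1)
                 \<^bold>\<longrightarrow> BAll (a+1) (Pair_in 1 0 (s'+2) \<^bold>\<longleftrightarrow> Pair_in 1 0 (s+2))))"

definition Closed_family :: "nat \<Rightarrow> nat \<Rightarrow> nat \<Rightarrow> fm" where
  "Closed_family d w a =
     (
      \<comment> \<open>\<open>i, j \<in> w\<close> and \<open>r = {s : w \<rightarrow> a. s(i) \<in> s(j)}\<close>; inside: 0 = v, 1 = u, 2 = s, 3 = r, 4 = j, 5 = i\<close>
      BAll w (BAll (w+1) (Forall Sets (
        Forall Sets (0 \<in>\<^sup>0 1 \<^bold>\<longleftrightarrow> (Function 0 (w+4) (a+4)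
          \<^bold>\<and> BEx (a+4) (BEx (a+5) (Pair_in 5 1 2 \<^bold>\<and> Pair_in 4 0 2 \<^bold>\<and> 1 \<in>\<^sup>0 0))))
        \<^bold>\<longrightarrow> 0 \<in>\<^sup>0 d+3)))
      \<^bold>\<and>
      \<comment> \<open>\<open>i, j \<in> w\<close> and \<open>r = {s : w \<rightarrow> a. s(i) = s(j)}\<close>; inside: 0 = u, 1 = s, 2 = r, 3 = j, 4 = i\<close>
      BAll w (BAll (w+1) (Forall Sets (
        Forall Sets (0 \<in>\<^sup>0 1 \<^bold>\<longleftrightarrow> (Function 0 (w+4) (a+4)
          \<^bold>\<and> BEx (a+4) (Pair_in 4 0 1 \<^bold>\<and> Pair_in 3 0 1)))
        \<^bold>\<longrightarrow> 0 \<in>\<^sup>0 d+3)))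
      \<^bold>\<and>
      \<comment> \<open>\<open>r \<in> d\<close> and \<open>q = {s : w \<rightarrow> a. s \<notin> r}\<close>; inside: 0 = s, 1 = q, 2 = r\<close>
      BAll d (Forall Sets (
        Forall Sets (0 \<in>\<^sup>0 1 \<^bold>\<longleftrightarrow> (Function 0 (w+3) (a+3) \<^bold>\<and> \<^bold>\<not> (0 \<in>\<^sup>0 2)))
        \<^bold>\<longrightarrow> 0 \<in>\<^sup>0 d+2))
      \<^bold>\<and>
      \<comment> \<open>\<open>r, r' \<in> d\<close> and \<open>q = r \<inter> r'\<close>; inside: 0 = s, 1 = q, 2 = r', 3 = r\<close>
      BAll d (BAll (d+1) (Forall Sets (
        Forall Sets (0 \<in>\<^sup>0 1 \<^bold>\<longleftrightarrow> (0 \<in>\<^sup>0 3 \<^bold>\<and> 0 \<in>\<^sup>0 2))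
        \<^bold>\<longrightarrow> 0 \<in>\<^sup>0 d+3)))
      \<^bold>\<and>
      \<comment> \<open>\<open>r \<in> d\<close>, \<open>i \<in> w\<close> and \<open>q = {s : w \<rightarrow> a. \<exists>x\<in>a. s(i := x) \<in> r}\<close>;
          inside: 0 = s(i := x), 1 = x, 2 = s, 3 = q, 4 = i, 5 = r\<close>
      BAll d (BAll (w+1) (Forall Sets (
        Forall Sets (0 \<in>\<^sup>0 1 \<^bold>\<longleftrightarrow> (Function 0 (w+4) (a+4)
          \<^bold>\<and> BEx (a+4) (BEx 4 (Is_update 0 2 4 1 (w+6) (a+6)))))
        \<^bold>\<longrightarrow> 0 \<in>\<^sup>0 d+3)))
     )"

text \<open>
  \<open>x\<close> is a subset of \<open>a\<close> definable over \<open>(a, \<in>)\<close> with parameters, i.e. \<open>x \<in> Def(a)\<close>: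
  \<open>x = {u \<in> a. s(0 := u) \<in> r}\<close> for some definable \<open>r\<close> and some \<open>s : \<omega> \<rightarrow> a\<close>, whose values
  provide the parameters.  The disjunct \<open>x = a\<close> only matters for \<open>a = {}\<close>, when there are
  no assignments.
\<close>

definition Definable_subset :: "nat \<Rightarrow> nat \<Rightarrow> fm" where
  "Definable_subset x a =
     (Subset x a
      \<^bold>\<and> (x \<^bold>= a \<^bold>\<or>
        \<comment> \<open>inside: 0 = s(0 := u), 1 = u, 2 = zero, 3 = r, 4 = s, 5 = omega\<close>
        Exists Sets (Is_omega 0 \<^bold>\<and> Exists Sets (Function 0 1 (a+2) \<^bold>\<and>
          Exists Sets (Forall Sets (Closed_family 0 3 (a+4) \<^bold>\<longrightarrow> 1 \<in>\<^sup>0 0) \<^bold>\<and>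
            BEx 2 (Empty 0 \<^bold>\<and>
              BAll (a+4) (0 \<in>\<^sup>0 x+5 \<^bold>\<longleftrightarrow> BEx 2 (Is_update 0 4 2 1 5 (a+6)))))))))"

text \<open>
  \<open>f\<close> is the constructible hierarchy \<open>\<beta> \<mapsto> L_\<beta>\<close> on the ordinal \<open>a\<close>, given by the recursion
  \<open>L_\<beta> = \<Union>{Def(L_\<gamma>) | \<gamma> \<in> \<beta>}\<close>.
\<close>

definition L_hierarchy :: "nat \<Rightarrow> nat \<Rightarrow> fm" where
  "L_hierarchy f a =
     (Ordinal a \<^bold>\<and> Exists Sets (Function (f+1) (a+1) 0) \<^bold>\<and>
      \<comment> \<open>inside: 0 = \<open>L_\<gamma>\<close>, 1 = \<open>\<gamma>\<close>, 2 = x, 3 = \<open>L_\<beta>\<close>, 4 = \<open>\<beta>\<close>\<close>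
      BAll a (Forall Sets (Pair_in 1 0 (f+2) \<^bold>\<longrightarrow>
        Forall Sets (0 \<in>\<^sup>0 1 \<^bold>\<longleftrightarrow>
          BEx 2 (Exists Sets (Pair_in 1 0 (f+5) \<^bold>\<and> Definable_subset 2 0))))))"

definition V_eq_L :: fm where
  \<comment> \<open>inside: 0 = \<open>L_\<beta>\<close>, 1 = \<open>\<beta>\<close>, 2 = hierarchy, 3 = its length, 4 = x\<close>
  "V_eq_L =
     Forall Sets (Exists Sets (Exists Sets (L_hierarchy 0 1 \<^bold>\<and> BEx 1 (Exists Sets (Pair_in 1 0 2 \<^bold>\<and> 4 \<in>\<^sup>0 0)))))"


section \<open>The axioms of MTT\<close>

definition Extensionality :: "mtype \<Rightarrow> fm" where
  "Extensionality t =
     (if t = Sets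
      then Forall Sets (Forall Sets (Forall Sets (0 \<in>\<^sup>0 2 \<^bold>\<longleftrightarrow> 0 \<in>\<^sup>0 1) \<^bold>\<longrightarrow> 1 \<^bold>= 0))
      else Forall t (Forall t (Forall (elt t) (Mem t 0 1 \<^bold>\<longleftrightarrow> Mem t 0 0) \<^bold>\<longrightarrow> Eq t 1 0)))"

text \<open>
  There is a \<open>y\<close> of type \<open>t\<close> whose members are precisely the \<open>x\<close> with \<open>\<phi>(x)\<close>.  In \<open>\<phi>\<close> the
  variable \<open>x\<close> has index 0; the renaming makes sure that \<open>y\<close> does not occur in \<open>\<phi>\<close>.
\<close>

definition Comprehension :: "mtype \<Rightarrow> fm \<Rightarrow> fm" where
  "Comprehension t \<phi> =
     Exists t (Forall (elt t)
       (Mem t 0 (if elt t = t then 1 else 0) \<^bold>\<longleftrightarrow> ren (up (elt t) (shift t)) \<phi>))"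

definition Pairing :: fm where
  "Pairing = Forall Sets (Forall Sets (Comprehension Sets (0 \<^bold>= 2 \<^bold>\<or> 0 \<^bold>= 1)))"

definition Union_of_set :: fm where
  "Union_of_set = Forall Sets (Comprehension Sets (BEx 1 (1 \<in>\<^sup>0 0)))"

definition Powerset :: fm where
  "Powerset = Forall Sets (Comprehension Sets (Subset 0 1))"

definition Infinity :: fm where
  "Infinity = Exists Sets (BEx 0 (Empty 0) \<^bold>\<and> BAll 0 (BEx 1 (Is_succ 0 1)))"

definition Foundation :: fm where
  "Foundation = Forall Sets (\<^bold>\<not> Empty 0 \<^bold>\<longrightarrow> BEx 0 (BAll 0 (\<^bold>\<not> (0 \<in>\<^sup>0 2))))"

definition Choice :: fm where  \<comment> \<open>a set of disjoint nonempty sets has a transversal\<close>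
  "Choice = Forall Sets (
     BAll 0 (\<^bold>\<not> Empty 0)
     \<^bold>\<and> BAll 0 (BAll 1 (BAll 1 (0 \<in>\<^sup>0 1 \<^bold>\<longrightarrow> 2 \<^bold>= 1)))
     \<^bold>\<longrightarrow> Exists Sets (BAll 1 (BEx 0 (0 \<in>\<^sup>0 2 \<^bold>\<and> BAll 1 (0 \<in>\<^sup>0 3 \<^bold>\<longrightarrow> 0 \<^bold>= 1)))))"

definition Transitive_containment :: fm where
  "Transitive_containment = Forall Sets (Exists Sets (Subset 1 0 \<^bold>\<and> Transitive 0))"

definition Bounded_separation :: "fm set" where
  "Bounded_separation = {Comprehension Sets (0 \<in>\<^sup>0 a+1 \<^bold>\<and> \<phi>) | a \<phi>. bounded_fm \<phi>}"

definition MAC :: "fm set" where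
  "MAC = {Extensionality Sets, Pairing, Union_of_set, Powerset, Infinity, Foundation, Choice,
          Transitive_containment} \<union> Bounded_separation"

definition MTT :: "fm set" where
  "MTT = MAC \<union> {V_eq_L}
     \<union> {Extensionality Classes, Extensionality Collections}
     \<union> {Comprehension Classes \<phi> | \<phi>. quantifies_over_sets \<phi>}
     \<union> {Comprehension Collections \<phi> | \<phi>. quantifies_over_sets \<phi>}"


section \<open>Class functions\<close>

definition Subset_of_class :: "nat \<Rightarrow> nat \<Rightarrow> fm"  (infix "\<subseteq>\<^sup>0" 50) where
  "a \<subseteq>\<^sup>0 B = BAll a (0 \<in>\<^sup>1 B)"

definition Pair_in_class :: "nat \<Rightarrow> nat \<Rightarrow> nat \<Rightarrow> fm" where
  "Pair_in_class x y G = Exists Sets (Is_pair 0 (x+1) (y+1) \<^bold>\<and> 0 \<in>\<^sup>1 G)"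

text \<open>\<open>A\<close> is the class \<open>{x | \<phi>(x)}\<^sup>1\<close>; in \<open>\<phi>\<close> the variable \<open>x\<close> has index 0.\<close>

definition Is_class_of :: "nat \<Rightarrow> fm \<Rightarrow> fm" where
  "Is_class_of A \<phi> = Forall Sets (0 \<in>\<^sup>1 A \<^bold>\<longleftrightarrow> \<phi>)"

text \<open>\<open>G\<close> is the graph of a class function from \<open>A\<close> to \<open>B\<close>.\<close>

definition Class_function :: "nat \<Rightarrow> nat \<Rightarrow> nat \<Rightarrow> fm" where
  "Class_function G A B =
     (Forall Sets (0 \<in>\<^sup>1 G \<^bold>\<longrightarrow> Exists Sets (0 \<in>\<^sup>1 A \<^bold>\<and> Exists Sets (0 \<in>\<^sup>1 B \<^bold>\<and> Is_pair 2 1 0)))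
      \<^bold>\<and> Forall Sets (0 \<in>\<^sup>1 A \<^bold>\<longrightarrow> Exists Sets (Pair_in_class 1 0 G))
      \<^bold>\<and> Forall Sets (Forall Sets (Forall Sets
           (Pair_in_class 2 1 G \<^bold>\<and> Pair_in_class 2 0 G \<^bold>\<longrightarrow> 1 \<^bold>= 0))))"

text \<open>
  Each \<open>a \<subseteq>\<^sup>0 A\<close> has a set image \<open>c \<subseteq>\<^sup>0 B\<close> under \<open>G\<close>, and the graph \<open>g\<close> of the restriction
  to \<open>a\<close> is a set contained in \<open>a \<times> c\<close>.
\<close>

definition Bounded :: "nat \<Rightarrow> nat \<Rightarrow> nat \<Rightarrow> fm" where
  "Bounded G A B =
     Forall Sets (0 \<subseteq>\<^sup>0 A \<^bold>\<longrightarrow>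
       Exists Sets (
         \<comment> \<open>0 = c, 1 = a\<close>
         0 \<subseteq>\<^sup>0 B
         \<^bold>\<and> Forall Sets (0 \<in>\<^sup>0 1 \<^bold>\<longleftrightarrow> BEx 2 (Pair_in_class 0 1 G))
         \<^bold>\<and> Exists Sets (
           \<comment> \<open>0 = g, 1 = c, 2 = a\<close>
           Forall Sets (0 \<in>\<^sup>0 1 \<^bold>\<longleftrightarrow> (0 \<in>\<^sup>1 G \<^bold>\<and> BEx 3 (Exists Sets (Is_pair 2 1 0))))
           \<^bold>\<and> BAll 0 (BEx 3 (BEx 3 (Is_pair 2 1 0))))))"

definition Bounded_class_function :: "nat \<Rightarrow> nat \<Rightarrow> nat \<Rightarrow> fm" where
  "Bounded_class_function G A B = (Class_function G A B \<^bold>\<and> Bounded G A B)"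

text \<open>There is a set \<open>b \<subseteq>\<^sup>0 B\<close> such that \<open>f\<close> is a function from \<open>a\<close> to \<open>b\<close>.\<close>

definition Function_into_class :: "nat \<Rightarrow> nat \<Rightarrow> nat \<Rightarrow> fm" where
  "Function_into_class f a B = Exists Sets (0 \<subseteq>\<^sup>0 B \<^bold>\<and> Function (f+1) (a+1) 0)"

end

theory Submission
  imports Defs "HOL-Library.Countable"
begin

text \<open>
  The calculus is complete for three-sorted structures (a Henkin construction whose terms are the
  variables), so the theorem may be checked in an arbitrary model.  There the graph class of a set
  function \<open>f\<close> is bounded because the image of a set and the restricted graph are cut out of the
  codomain and of \<open>f\<close> by bounded separation.  Conversely, boundedness of \<open>G\<close>, applied to the
  set \<open>a\<close> itself, yields a set image \<open>c\<close> and a set with the same members as \<open>G\<close>.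
\<close>

section \<open>Renaming\<close>

text \<open>Into \<open>nat\<close> this is the substitution for the variable 0 of sort
  \<open>t\<close>; into a model it is the extension of an assignment under a quantifier. Sharing it
  makes the two interact by plain composition.\<close>

definition bind :: "mtype \<Rightarrow> 'a \<Rightarrow> (mtype \<Rightarrow> nat \<Rightarrow> 'a) \<Rightarrow> mtype \<Rightarrow> nat \<Rightarrow> 'a" where
  "bind t x e = (\<lambda>s n. if s = t then (case n of 0 \<Rightarrow> x | Suc m \<Rightarrow> e s m) else e s n)"

lemma bind_simps [simp]:
  "bind t x e t 0 = x"
  "bind t x e t (Suc n) = e t n"
  "s \<noteq> t \<Longrightarrow> bind t x e s n = e s n"
  by (simp_all add: bind_def)

lemma bind_numeral [simp]:
  "bind t x e t 1 = e t 0"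
  "bind t x e t (numeral k) = e t (pred_numeral k)"
  "bind t x e t (n + 1) = e t n"
  "bind t x e t (n + numeral k) = e t (n + pred_numeral k)"
  by (simp_all add: bind_def numeral_eq_Suc)

lemma inst_eq_ren_bind: "inst t k \<phi> = ren (bind t k (\<lambda>_ n. n)) \<phi>"
  unfolding inst_def bind_def by (rule arg_cong[where f = "\<lambda>\<rho>. ren \<rho> \<phi>"]) (auto split: nat.split)

lemma up_comp: "up t \<rho> s (up t \<sigma> s n) = up t (\<lambda>s n. \<rho> s (\<sigma> s n)) s n"
  by (auto simp: up_def split: nat.split)

lemma ren_ren: "ren \<rho> (ren \<sigma> \<phi>) = ren (\<lambda>s n. \<rho> s (\<sigma> s n)) \<phi>"
  by (induction \<phi> arbitrary: \<rho> \<sigma>) (simp_all add: up_comp)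

lemma up_id: "up t (\<lambda>_ n. n) = (\<lambda>_ n. n)"
  by (auto simp: up_def fun_eq_iff split: nat.split)

lemma ren_id: "ren (\<lambda>_ n. n) \<phi> = \<phi>"
  by (induction \<phi>) (simp_all add: up_id)

lemma ren_up_shift: "ren (up t \<rho>) (ren (shift t) \<phi>) = ren (shift t) (ren \<rho> \<phi>)"
  unfolding ren_ren
  by (rule arg_cong[where f = "\<lambda>\<rho>. ren \<rho> \<phi>"]) (auto simp: up_def shift_def fun_eq_iff)

lemma ren_bind_ren_up: "ren (bind t k \<sigma>) (ren (up t \<rho>) \<phi>) = ren (bind t k (\<lambda>s n. \<sigma> s (\<rho> s n))) \<phi>"
  unfolding ren_ren
  by (rule arg_cong[where f = "\<lambda>\<rho>. ren \<rho> \<phi>"]) (auto simp: up_def bind_def fun_eq_iff split: nat.split)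

lemma ren_inst: "ren \<rho> (inst t k \<phi>) = inst t (\<rho> t k) (ren (up t \<rho>) \<phi>)"
  unfolding inst_eq_ren_bind ren_bind_ren_up ren_ren
  by (rule arg_cong[where f = "\<lambda>\<rho>. ren \<rho> \<phi>"]) (auto simp: up_def bind_def fun_eq_iff split: nat.split)

text \<open>Only finitely many indices occur in a formula. Under a quantifier the same bound serves,
  since \<open>up\<close> turns agreement below \<open>N\<close> into agreement below
  \<open>Suc N\<close>. This supplies fresh variables later.\<close>

lemma ren_finite_support:
  "\<exists>N. \<forall>\<rho> \<sigma>. (\<forall>t. \<forall>n<N. \<rho> t n = \<sigma> t n) \<longrightarrow> ren \<rho> \<phi> = ren \<sigma> \<phi>"
proof (induction \<phi>)
  case (Eq t i j)
  show ?case by (rule exI[of _ "Suc (max i j)"]) simp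
next
  case (Mem t i j)
  show ?case by (rule exI[of _ "Suc (max i j)"]) simp
next
  case (Imp \<phi> \<psi>)
  then obtain M N where
    "\<forall>\<rho> \<sigma>. (\<forall>t. \<forall>n<M. \<rho> t n = \<sigma> t n) \<longrightarrow> ren \<rho> \<phi> = ren \<sigma> \<phi>"
    "\<forall>\<rho> \<sigma>. (\<forall>t. \<forall>n<N. \<rho> t n = \<sigma> t n) \<longrightarrow> ren \<rho> \<psi> = ren \<sigma> \<psi>"
    by blast
  then show ?case by (intro exI[of _ "max M N"]) simp
next
  case (Forall t \<phi>)
  then obtain N where N: "\<And>\<rho> \<sigma>. (\<forall>t. \<forall>n<N. \<rho> t n = \<sigma> t n) \<Longrightarrow> ren \<rho> \<phi> = ren \<sigma> \<phi>"
    by blast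
  show ?case
    by (rule exI[of _ N]) (auto intro!: N simp: up_def split: nat.split)
qed simp

lemma ren_finite_support_list:
  "\<exists>N. \<forall>\<phi>\<in>set \<Gamma>. \<forall>\<rho> \<sigma>. (\<forall>t. \<forall>n<N. \<rho> t n = \<sigma> t n) \<longrightarrow> ren \<rho> \<phi> = ren \<sigma> \<phi>"
proof (induction \<Gamma>)
  case (Cons \<psi> \<Gamma>)
  then obtain M where
    M: "\<forall>\<phi>\<in>set \<Gamma>. \<forall>\<rho> \<sigma>. (\<forall>t. \<forall>n<M. \<rho> t n = \<sigma> t n) \<longrightarrow> ren \<rho> \<phi> = ren \<sigma> \<phi>"
    by (elim exE)
  obtain N where
    "\<forall>\<rho> \<sigma>. (\<forall>t. \<forall>n<N. \<rho> t n = \<sigma> t n) \<longrightarrow> ren \<rho> \<psi> = ren \<sigma> \<psi>"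
    using ren_finite_support[of \<psi>] by (elim exE)
  with M show ?case by (intro exI[of _ "max M N"]) simp
qed simp


section \<open>Completeness\<close>

text \<open>Comparing the contexts as sets lets weakening cover exchange and contraction as
  well.\<close>

lemma derivable_weaken: "derivable T \<Gamma> \<phi> \<Longrightarrow> set \<Gamma> \<subseteq> set \<Delta> \<Longrightarrow> derivable T \<Delta> \<phi>"
proof (induction arbitrary: \<Delta> rule: derivable.induct)
  case (ImpI \<phi> \<Gamma> \<psi>)
  have "derivable T (\<phi> # \<Delta>) \<psi>" by (rule ImpI.IH) (use ImpI.prems in auto)
  then show ?case by (rule derivable.ImpI)
next
  case (Classical \<phi> \<Gamma>)
  have "derivable T ((\<^bold>\<not> \<phi>) # \<Delta>) Falsum" by (rule Classical.IH) (use Classical.prems in auto)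
  then show ?case by (rule derivable.Classical)
next
  case (AllI t \<Gamma> \<phi>)
  have "derivable T (map (ren (shift t)) \<Delta>) \<phi>" by (rule AllI.IH) (use AllI.prems in auto)
  then show ?case by (rule derivable.AllI)
next
  case (EqSubst \<Gamma> t k l \<phi>)
  then show ?case by (blast intro: derivable.EqSubst)
qed (blast intro: Axiom Assm ImpE AllE EqRefl)+

lemma derivable_mono: "derivable S \<Gamma> \<phi> \<Longrightarrow> S \<subseteq> T \<Longrightarrow> derivable T \<Gamma> \<phi>"
  by (induction rule: derivable.induct) (blast intro: derivable.intros)+

lemma derivable_explosion: "derivable T \<Gamma> Falsum \<Longrightarrow> derivable T \<Gamma> \<phi>"
  by (rule derivable.Classical, erule derivable_weaken) auto

lemma derivable_eq_sym: "derivable T \<Gamma> (Eq t i j) \<Longrightarrow> derivable T \<Gamma> (Eq t j i)"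
  using EqSubst[of T \<Gamma> t i j "Eq t 0 (Suc i)"] EqRefl[of T \<Gamma> t i] by (simp add: inst_eq_ren_bind)

lemma derivable_eq_trans:
  "derivable T \<Gamma> (Eq t i j) \<Longrightarrow> derivable T \<Gamma> (Eq t j k) \<Longrightarrow> derivable T \<Gamma> (Eq t i k)"
  using EqSubst[of T \<Gamma> t j k "Eq t (Suc i) 0"] by (simp add: inst_eq_ren_bind)

lemma derivable_mem_cong:
  assumes "derivable T \<Gamma> (Eq (elt t) i i')" "derivable T \<Gamma> (Eq t j j')" "derivable T \<Gamma> (Mem t i j)"
  shows "derivable T \<Gamma> (Mem t i' j')"
proof -
  \<comment> \<open>Only for \<open>Sets\<close> do member and container share an index space; then
    the parameter has to be shifted past the variable 0 that is being substituted.\<close>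
  have "derivable T \<Gamma> (Mem t i' j)"
    using EqSubst[OF assms(1), of "Mem t 0 (if elt t = t then Suc j else j)"] assms(3)
    by (cases t) (simp_all add: inst_eq_ren_bind)
  then show ?thesis
    using EqSubst[OF assms(2), of "Mem t (if elt t = t then Suc i' else i') 0"]
    by (cases t) (simp_all add: inst_eq_ren_bind)
qed

section \<open>Three-sorted structures and satisfaction\<close>

primrec sat ::
  "(mtype \<Rightarrow> 'a set) \<Rightarrow> (mtype \<Rightarrow> 'a \<Rightarrow> 'a \<Rightarrow> bool) \<Rightarrow> (mtype \<Rightarrow> nat \<Rightarrow> 'a) \<Rightarrow> fm \<Rightarrow> bool" where
  "sat D E e Falsum \<longleftrightarrow> False"
| "sat D E e (Eq t i j) \<longleftrightarrow> e t i = e t j"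
| "sat D E e (Mem t i j) \<longleftrightarrow> E t (e (elt t) i) (e t j)"
| "sat D E e (\<phi> \<^bold>\<longrightarrow> \<psi>) \<longleftrightarrow> (sat D E e \<phi> \<longrightarrow> sat D E e \<psi>)"
| "sat D E e (Forall t \<phi>) \<longleftrightarrow> (\<forall>x\<in>D t. sat D E (bind t x e) \<phi>)"

lemma sat_connectives [simp]:
  "sat D E e (\<^bold>\<not> \<phi>) \<longleftrightarrow> \<not> sat D E e \<phi>"
  "sat D E e (\<phi> \<^bold>\<and> \<psi>) \<longleftrightarrow> sat D E e \<phi> \<and> sat D E e \<psi>"
  "sat D E e (\<phi> \<^bold>\<or> \<psi>) \<longleftrightarrow> sat D E e \<phi> \<or> sat D E e \<psi>"
  "sat D E e (\<phi> \<^bold>\<longleftrightarrow> \<psi>) \<longleftrightarrow> (sat D E e \<phi> \<longleftrightarrow> sat D E e \<psi>)"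
  "sat D E e (Exists t \<phi>) \<longleftrightarrow> (\<exists>x\<in>D t. sat D E (bind t x e) \<phi>)"
  by auto

lemma sat_ren: "sat D E e (ren \<rho> \<phi>) \<longleftrightarrow> sat D E (\<lambda>t n. e t (\<rho> t n)) \<phi>"
proof (induction \<phi> arbitrary: e \<rho>)
  case (Forall t \<phi>)
  have "(\<lambda>s n. bind t x e s (up t \<rho> s n)) = bind t x (\<lambda>s n. e s (\<rho> s n))" for x
    by (auto simp: bind_def up_def fun_eq_iff split: nat.split)
  then show ?case by (simp add: Forall)
qed simp_all

definition consistent :: "fm set \<Rightarrow> fm list \<Rightarrow> bool" where
  "consistent T \<Gamma> \<longleftrightarrow> \<not> derivable T \<Gamma> Falsum"

instance mtype :: countable by countable_datatype
instance fm :: countable by countable_datatype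

text \<open>
  Axioms are not subject to the eigenvariable condition of \<open>AllI\<close>.  For a theory closed under
  renaming this is harmless: every derivation can be renamed as a whole, and any finite context
  leaves a variable fresh, whatever variables occur in the axioms.
\<close>

locale renaming_closed =
  fixes T :: "fm set"
  assumes ren_closed: "\<phi> \<in> T \<Longrightarrow> ren \<rho> \<phi> \<in> T"
begin

lemma derivable_ren: "derivable T \<Gamma> \<phi> \<Longrightarrow> derivable T (map (ren \<rho>) \<Gamma>) (ren \<rho> \<phi>)"
proof (induction arbitrary: \<rho> rule: derivable.induct)
  case (AllI t \<Gamma> \<phi>)
  have "derivable T (map (ren (shift t)) (map (ren \<rho>) \<Gamma>)) (ren (up t \<rho>) \<phi>)"
    using AllI.IH[of "up t \<rho>"] by (simp add: ren_up_shift o_def)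
  then show ?case by (simp add: derivable.AllI)
next
  case (AllE \<Gamma> t \<phi> k)
  then show ?case by (simp add: ren_inst derivable.AllE)
next
  case (EqSubst \<Gamma> t k l \<phi>)
  then show ?case unfolding ren_inst ren.simps by (blast intro: derivable.EqSubst)
next
  case (Axiom \<phi> \<Gamma>)
  then show ?case by (simp add: derivable.Axiom ren_closed)
next
  case (ImpI \<phi> \<Gamma> \<psi>)
  then show ?case by (simp add: derivable.ImpI)
next
  case (ImpE \<Gamma> \<phi> \<psi>)
  then show ?case by (metis derivable.ImpE ren.simps(4))
next
  case (Classical \<phi> \<Gamma>)
  then show ?case by (simp add: derivable.Classical)
qed (auto intro: derivable.Assm derivable.EqRefl)

text \<open>The eigenvariable rule with a named variable: \<open>k\<close> is chosen beyond all
  indices occurring in \<open>\<phi>\<close> and \<open>\<Gamma>\<close>.\<close>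

lemma derivable_generalize: "\<exists>k. derivable T \<Gamma> (inst t k \<phi>) \<longrightarrow> derivable T \<Gamma> (Forall t \<phi>)"
proof -
  obtain k where k: "\<And>\<psi> \<rho> \<sigma>. \<psi> \<in> set (\<phi> # \<Gamma>) \<Longrightarrow> (\<forall>t. \<forall>n<k. \<rho> t n = \<sigma> t n) \<Longrightarrow> ren \<rho> \<psi> = ren \<sigma> \<psi>"
    using ren_finite_support_list[of "\<phi> # \<Gamma>"] by blast
  \<comment> \<open>On indices below \<open>k\<close>, \<open>\<rho>\<close> acts as
    \<open>shift t\<close>; sending \<open>k\<close> back to 0, it also undoes the instantiation.
    Renaming the whole derivation by it therefore produces the premise of
    \<open>AllI\<close>.\<close>
  define \<rho> where "\<rho> = (\<lambda>s n. if s = t then (if n = k then 0 else Suc n) else n)"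
  have "map (ren \<rho>) \<Gamma> = map (ren (shift t)) \<Gamma>"
    by (rule map_cong[OF refl], rule k) (auto simp: \<rho>_def shift_def)
  moreover have "ren \<rho> (inst t k \<phi>) = ren (\<lambda>_ n. n) \<phi>"
    unfolding inst_eq_ren_bind ren_ren by (rule k) (auto simp: \<rho>_def bind_def split: nat.split)
  ultimately have "derivable T \<Gamma> (Forall t \<phi>)" if "derivable T \<Gamma> (inst t k \<phi>)"
    using derivable_ren[OF that, of \<rho>] by (intro AllI) (simp only: ren_id)
  then show ?thesis by blast
qed

text \<open>The Henkin condition: a refuted universal formula must come with a refuted instance.
  Having a variable as witness keeps the language unchanged.\<close>

definition settles :: "fm list \<Rightarrow> fm \<Rightarrow> bool" where
  "settles \<Gamma> \<psi> \<longleftrightarrow> derivable T \<Gamma> \<psi> \<or>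
     derivable T \<Gamma> (\<^bold>\<not> \<psi>) \<and> (\<forall>t \<phi>. \<psi> = Forall t \<phi> \<longrightarrow> (\<exists>k. derivable T \<Gamma> (\<^bold>\<not> inst t k \<phi>)))"

text \<open>An underivable \<open>\<psi>\<close> may be negated consistently. If it is universal,
  the negated instance at the fresh \<open>k\<close> may be added too: otherwise that instance, and
  with it \<open>\<psi>\<close>, would be derivable.\<close>

lemma ex_settles:
  assumes "consistent T \<Gamma>"
  shows "\<exists>\<Delta>. consistent T \<Delta> \<and> set \<Gamma> \<subseteq> set \<Delta> \<and> settles \<Delta> \<psi>"
proof (cases "derivable T \<Gamma> \<psi>")
  case True
  then show ?thesis using assms by (auto simp: settles_def)
next
  case False
  let ?\<Delta> = "(\<^bold>\<not> \<psi>) # \<Gamma>"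
  have cons: "consistent T ?\<Delta>" using False Classical unfolding consistent_def by blast
  show ?thesis
  proof (cases "\<exists>t \<phi>. \<psi> = Forall t \<phi>")
    case False
    then show ?thesis using cons
      by (intro exI[of _ ?\<Delta>]) (auto simp: settles_def intro: Assm)
  next
    case True
    then obtain t \<phi> where \<psi>: "\<psi> = Forall t \<phi>" by blast
    obtain k where k: "derivable T ?\<Delta> (inst t k \<phi>) \<longrightarrow> derivable T ?\<Delta> \<psi>"
      using derivable_generalize \<psi> by blast
    have "\<not> derivable T ?\<Delta> \<psi>"
      using cons ImpE[of T ?\<Delta> \<psi> Falsum] Assm[of "\<^bold>\<not> \<psi>" ?\<Delta>] unfolding consistent_def by auto
    then have "consistent T ((\<^bold>\<not> inst t k \<phi>) # ?\<Delta>)"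
      using k Classical unfolding consistent_def by blast
    moreover have "derivable T ((\<^bold>\<not> inst t k \<phi>) # ?\<Delta>) (\<^bold>\<not> inst t k \<phi>)"
      "derivable T ((\<^bold>\<not> inst t k \<phi>) # ?\<Delta>) (\<^bold>\<not> \<psi>)"
      by (simp_all add: Assm)
    ultimately show ?thesis using \<psi>
      by (intro exI[of _ "(\<^bold>\<not> inst t k \<phi>) # ?\<Delta>"]) (auto simp: settles_def)
  qed
qed

text \<open>Elements of the term model are classes of variable indices, so validity over
  \<open>nat set\<close> suffices. Axioms must hold under every assignment, in accordance with their
  reading as universal closures.\<close>

theorem completeness:
  assumes valid: "\<And>D E (e :: mtype \<Rightarrow> nat \<Rightarrow> nat set).
      (\<And>\<psi> e. \<psi> \<in> T \<Longrightarrow> (\<And>t n. e t n \<in> D t) \<Longrightarrow> sat D E e \<psi>) \<Longrightarrow>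
      (\<And>t n. e t n \<in> D t) \<Longrightarrow> sat D E e \<phi>"
  shows "T \<turnstile> \<phi>"
proof (rule ccontr)
  assume "\<not> (T \<turnstile> \<phi>)"
  then have "consistent T [\<^bold>\<not> \<phi>]"
    using Classical unfolding consistent_def provable_def by blast
  \<comment> \<open>A growing chain of finite consistent contexts: it starts from the negated goal,
    and stage \<open>Suc n\<close> settles the formula with code \<open>n\<close>.\<close>
  then have "\<exists>G. \<forall>n. (consistent T (G n) \<and> (n = 0 \<longrightarrow> set [\<^bold>\<not> \<phi>] \<subseteq> set (G n))) \<and>
      set (G n) \<subseteq> set (G (Suc n)) \<and> settles (G (Suc n)) (from_nat n)"
    by (intro dependent_nat_choice) (use ex_settles in auto)
  then obtain G where G: "\<And>n. consistent T (G n) \<and> (n = 0 \<longrightarrow> set [\<^bold>\<not> \<phi>] \<subseteq> set (G n))"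
    and step: "\<And>n. set (G n) \<subseteq> set (G (Suc n)) \<and> settles (G (Suc n)) (from_nat n)"
    by blast
  have G0: "set [\<^bold>\<not> \<phi>] \<subseteq> set (G 0)" and cons: "\<And>n. consistent T (G n)" using G by blast+
  have G_mono: "set (G m) \<subseteq> set (G n)" if "m \<le> n" for m n
    by (rule lift_Suc_mono_le[of "\<lambda>n. set (G n)"]) (use step that in auto)
  \<comment> \<open>The deductive closure of the whole chain: consistent, complete and with
    witnesses.\<close>
  define H where "H = {\<psi>. \<exists>n. derivable T (G n) \<psi>}"
  \<comment> \<open>Rules with one or two premises lift from the contexts to \<open>H\<close>; two
    premises derived at different stages meet at the later one.\<close>
  have H_rule1: "\<psi> \<in> H" if "\<chi> \<in> H" "\<And>n. derivable T (G n) \<chi> \<Longrightarrow> derivable T (G n) \<psi>" for \<psi> \<chi>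
    using that unfolding H_def by blast
  have H_rule2: "\<psi> \<in> H"
    if *: "\<chi> \<in> H" "\<theta> \<in> H"
      "\<And>n. derivable T (G n) \<chi> \<Longrightarrow> derivable T (G n) \<theta> \<Longrightarrow> derivable T (G n) \<psi>" for \<psi> \<chi> \<theta>
  proof -
    obtain m n where "derivable T (G m) \<chi>" "derivable T (G n) \<theta>"
      using *(1,2) unfolding H_def by blast
    then have "derivable T (G (max m n)) \<chi>" "derivable T (G (max m n)) \<theta>"
      by (auto intro: derivable_weaken[OF _ G_mono])
    then show ?thesis using *(3) unfolding H_def by blast
  qed
  have H_Falsum: "Falsum \<notin> H" using cons unfolding H_def consistent_def by blast
  have H_ImpE: "\<psi> \<in> H" if "(\<chi> \<^bold>\<longrightarrow> \<psi>) \<in> H" "\<chi> \<in> H" for \<chi> \<psi>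
    using that by (rule H_rule2) (rule ImpE)
  have H_settled: "\<psi> \<in> H \<or> (\<^bold>\<not> \<psi>) \<in> H \<and> (\<forall>t \<phi>. \<psi> = Forall t \<phi> \<longrightarrow> (\<exists>k. (\<^bold>\<not> inst t k \<phi>) \<in> H))" for \<psi>
    using step[of "to_nat \<psi>"] unfolding settles_def H_def by auto
  have H_Imp: "(\<chi> \<^bold>\<longrightarrow> \<psi>) \<in> H \<longleftrightarrow> (\<chi> \<in> H \<longrightarrow> \<psi> \<in> H)" for \<chi> \<psi>
  proof
    assume *: "\<chi> \<in> H \<longrightarrow> \<psi> \<in> H"
    show "(\<chi> \<^bold>\<longrightarrow> \<psi>) \<in> H"
    proof (cases "\<chi> \<in> H")
      case True
      then have "\<psi> \<in> H" using * by blast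
      then show ?thesis by (rule H_rule1) (rule ImpI, erule derivable_weaken, auto)
    next
      case False
      then have "(\<^bold>\<not> \<chi>) \<in> H" using H_settled by blast
      then show ?thesis
      proof (rule H_rule1)
        fix n assume "derivable T (G n) (\<^bold>\<not> \<chi>)"
        then have "derivable T (\<chi> # G n) (\<^bold>\<not> \<chi>)" by (rule derivable_weaken) auto
        then have "derivable T (\<chi> # G n) Falsum" by (rule ImpE) (simp add: Assm)
        then show "derivable T (G n) (\<chi> \<^bold>\<longrightarrow> \<psi>)" by (rule ImpI[OF derivable_explosion])
      qed
    qed
  qed (use H_ImpE in blast)
  have H_Forall: "Forall t \<psi> \<in> H \<longleftrightarrow> (\<forall>k. inst t k \<psi> \<in> H)" for t \<psi>
  proof
    assume *: "Forall t \<psi> \<in> H"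
    show "\<forall>k. inst t k \<psi> \<in> H" by (rule allI, rule H_rule1[OF *]) (rule AllE)
  next
    assume "\<forall>k. inst t k \<psi> \<in> H"
    then show "Forall t \<psi> \<in> H" using H_settled[of "Forall t \<psi>"] H_ImpE H_Falsum by blast
  qed
  \<comment> \<open>Equality is interpreted as identity, so the elements of the model are variables
    modulo equality in \<open>H\<close>, sort by sort.\<close>
  define r where "r = (\<lambda>t i. {l. Eq t i l \<in> H})"
  have H_refl: "Eq t i i \<in> H" for t i unfolding H_def using EqRefl by blast
  have H_sym: "Eq t j i \<in> H" if "Eq t i j \<in> H" for t i j
    using that by (rule H_rule1) (rule derivable_eq_sym)
  have H_trans: "Eq t i k \<in> H" if "Eq t i j \<in> H" "Eq t j k \<in> H" for t i j k
    using that by (rule H_rule2) (rule derivable_eq_trans)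
  have r_eq: "r t i = r t j \<longleftrightarrow> Eq t i j \<in> H" for t i j
    unfolding r_def set_eq_iff mem_Collect_eq using H_refl H_sym H_trans by meson
  have H_mem_cong: "Mem t i' j' \<in> H"
    if "Mem t i j \<in> H" "Eq (elt t) i i' \<in> H" "Eq t j j' \<in> H" for t i j i' j'
  proof -
    have "Mem t i' j \<in> H"
      using that(2,1) by (rule H_rule2) (rule derivable_mem_cong, auto intro: EqRefl)
    with that(3) show ?thesis
      by (rule H_rule2) (rule derivable_mem_cong, auto intro: EqRefl)
  qed
  define D where "D = (\<lambda>t. range (r t))"
  define E where "E = (\<lambda>t x y. \<exists>i j. x = r (elt t) i \<and> y = r t j \<and> Mem t i j \<in> H)"
  have E_iff: "E t (r (elt t) i) (r t j) \<longleftrightarrow> Mem t i j \<in> H" for t i j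
    unfolding E_def r_eq using H_mem_cong H_refl H_sym by blast
  \<comment> \<open>The truth lemma is stated for an arbitrary renaming \<open>e\<close> so that the
    induction passes quantifiers: assigning \<open>r t k\<close> to the bound variable is the same
    as renaming it to \<open>k\<close>.\<close>
  have truth: "sat D E (\<lambda>t n. r t (e t n)) \<psi> \<longleftrightarrow> ren e \<psi> \<in> H" for e \<psi>
  proof (induction \<psi> arbitrary: e)
    case (Forall t \<psi>)
    have "bind t (r t k) (\<lambda>t n. r t (e t n)) = (\<lambda>s n. r s (bind t k e s n))" for k
      by (auto simp: bind_def fun_eq_iff split: nat.split)
    moreover have "(\<forall>x\<in>D t. P x) \<longleftrightarrow> (\<forall>k. P (r t k))" for P by (simp add: D_def)
    ultimately show ?case by (simp add: Forall H_Forall inst_eq_ren_bind ren_bind_ren_up)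
  qed (simp_all add: H_Falsum r_eq E_iff H_Imp)
  \<comment> \<open>Every assignment into the model is \<open>r\<close> after some renaming, so
    closure of \<open>T\<close> under renaming makes the axioms true under all assignments.\<close>
  have "sat D E e \<psi>" if "\<psi> \<in> T" "\<And>t n. e t n \<in> D t" for \<psi> e
  proof -
    have "\<forall>t n. \<exists>k. e t n = r t k" using that(2) unfolding D_def by blast
    then obtain \<rho> where "e = (\<lambda>t n. r t (\<rho> t n))" by (metis ext)
    moreover have "ren \<rho> \<psi> \<in> H" unfolding H_def using that(1) ren_closed Axiom by blast
    ultimately show ?thesis by (simp add: truth)
  qed
  then have "sat D E (\<lambda>t n. r t n) \<phi>" by (rule valid) (auto simp: D_def)
  then have "\<phi> \<in> H" using truth[of "\<lambda>_ n. n" \<phi>] by (simp add: ren_id)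
  moreover have "(\<^bold>\<not> \<phi>) \<in> H" using G0 unfolding H_def by (auto intro: Assm)
  ultimately show False using H_ImpE H_Falsum by blast
qed

end


section \<open>Models of bounded separation and class comprehension\<close>

text \<open>The renaming inside \<open>Comprehension\<close> skips the index of the new object
  \<open>y\<close>, so \<open>\<phi>\<close> is evaluated in an assignment without
  \<open>y\<close>.\<close>

lemma sat_Comprehension:
  "sat D E e (Comprehension t \<phi>) \<longleftrightarrow>
     (\<exists>y\<in>D t. \<forall>x\<in>D (elt t). E t x y \<longleftrightarrow> sat D E (bind (elt t) x e) \<phi>)"
proof -
  have "(\<lambda>s n. bind (elt t) x (bind t y e) s (up (elt t) (shift t) s n)) = bind (elt t) x e" for x y
    by (auto simp: bind_def up_def shift_def fun_eq_iff split: nat.split)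
  then show ?thesis by (cases t) (auto simp: Comprehension_def sat_ren)
qed

lemma ren_Comprehension:
  "ren \<rho> (Comprehension t \<phi>) = Comprehension t (ren (up (elt t) \<rho>) \<phi>)"
proof -
  have "(\<lambda>s n. up (elt t) (up t \<rho>) s (up (elt t) (shift t) s n)) =
      (\<lambda>s n. up (elt t) (shift t) s (up (elt t) \<rho> s n))"
    by (auto simp: up_def shift_def fun_eq_iff split: nat.split)
  moreover have "up (elt t) (up t \<rho>) t (if elt t = t then 1 else 0) = (if elt t = t then 1 else 0)"
    "up (elt t) (up t \<rho>) (elt t) 0 = 0"
    by (auto simp: up_def)
  ultimately show ?thesis by (simp add: Comprehension_def ren_ren)
qed

lemma quantifies_over_sets_ren: "quantifies_over_sets (ren \<rho> \<phi>) = quantifies_over_sets \<phi>"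
  by (induction \<phi> arbitrary: \<rho>) simp_all

lemma bounded_fm_ren: "bounded_fm \<phi> \<Longrightarrow> bounded_fm (ren \<rho> \<phi>)"
proof (induction arbitrary: \<rho> rule: bounded_fm.induct)
  case (5 \<phi> a)
  then show ?case using bounded_fm.intros(5) by (simp add: up_def)
qed (auto intro: bounded_fm.intros)

lemma bounded_fm_BEx: "bounded_fm \<phi> \<Longrightarrow> bounded_fm (BEx a \<phi>)"
  by (intro bounded_fm.intros)

lemma bounded_fm_Is_upair: "bounded_fm (Is_upair u x y)"
  unfolding Is_upair_def by (intro bounded_fm.intros)

lemma bounded_fm_Is_pair: "bounded_fm (Is_pair p x y)"
  unfolding Is_pair_def by (intro bounded_fm.intros bounded_fm_Is_upair)

lemma bounded_fm_Pair_in: "bounded_fm (Pair_in x y f)"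
  unfolding Pair_in_def by (intro bounded_fm_BEx bounded_fm_Is_pair)

text \<open>The fragment of \<open>MTT\<close> in which the theorem is derived; the result then
  transfers to \<open>MTT\<close> by monotonicity.\<close>

definition set_class_comprehension :: "fm set" where
  "set_class_comprehension =
     Bounded_separation \<union> {Comprehension Classes \<phi> | \<phi>. quantifies_over_sets \<phi>}"

lemma renaming_closed_set_class_comprehension: "renaming_closed set_class_comprehension"
proof
  fix \<phi> \<rho> assume "\<phi> \<in> set_class_comprehension"
  then consider a \<psi> where "\<phi> = Comprehension Sets (0 \<in>\<^sup>0 a+1 \<^bold>\<and> \<psi>)" "bounded_fm \<psi>"
    | \<psi> where "\<phi> = Comprehension Classes \<psi>" "quantifies_over_sets \<psi>"
    unfolding set_class_comprehension_def Bounded_separation_def by blast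
  then show "ren \<rho> \<phi> \<in> set_class_comprehension"
  proof cases
    case 1
    then have "ren \<rho> \<phi> = Comprehension Sets (0 \<in>\<^sup>0 \<rho> Sets a + 1 \<^bold>\<and> ren (up Sets \<rho>) \<psi>)"
      by (simp add: ren_Comprehension up_def)
    then show ?thesis using 1 bounded_fm_ren
      unfolding set_class_comprehension_def Bounded_separation_def by blast
  next
    case 2
    then show ?thesis
      by (auto simp: set_class_comprehension_def ren_Comprehension quantifies_over_sets_ren)
  qed
qed

locale comprehension_model =
  fixes D :: "mtype \<Rightarrow> 'a set" and E :: "mtype \<Rightarrow> 'a \<Rightarrow> 'a \<Rightarrow> bool" and e\<^sub>0 :: "mtype \<Rightarrow> nat \<Rightarrow> 'a"
  assumes e\<^sub>0: "e\<^sub>0 t n \<in> D t"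
    and sat_axiom: "\<psi> \<in> set_class_comprehension \<Longrightarrow> (\<And>t n. e t n \<in> D t) \<Longrightarrow> sat D E e \<psi>"
begin

abbreviation S where "S \<equiv> D Sets"
abbreviation C where "C \<equiv> D Classes"
abbreviation M where "M \<equiv> E Sets"
abbreviation M1 where "M1 \<equiv> E Classes"

lemma bind_in_D: "x \<in> D t \<Longrightarrow> (\<And>s n. e s n \<in> D s) \<Longrightarrow> bind t x e s n \<in> D s"
  by (simp add: bind_def split: nat.split)

lemma separation:
  assumes "bounded_fm \<phi>" "\<And>t n. e t n \<in> D t"
  obtains y where "y \<in> S"
    "\<And>x. x \<in> S \<Longrightarrow> M x y \<longleftrightarrow> M x (e Sets a) \<and> sat D E (bind Sets x e) \<phi>"
proof -
  have "Comprehension Sets (0 \<in>\<^sup>0 a+1 \<^bold>\<and> \<phi>) \<in> set_class_comprehension"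
    unfolding set_class_comprehension_def Bounded_separation_def using assms(1) by blast
  from sat_axiom[where e = e, OF this assms(2)] show ?thesis
    using that by (auto simp: sat_Comprehension)
qed

lemma class_comprehension:
  assumes "quantifies_over_sets \<phi>" "\<And>t n. e t n \<in> D t"
  obtains y where "y \<in> C" "\<And>x. x \<in> S \<Longrightarrow> M1 x y \<longleftrightarrow> sat D E (bind Sets x e) \<phi>"
proof -
  have "Comprehension Classes \<phi> \<in> set_class_comprehension"
    unfolding set_class_comprehension_def using assms(1) by blast
  from sat_axiom[where e = e, OF this assms(2)] show ?thesis
    using that by (auto simp: sat_Comprehension)
qed

section \<open>The vocabulary of sets and class functions read in a model\<close>

definition upair where
  "upair u x y \<longleftrightarrow> M x u \<and> M y u \<and> (\<forall>z\<in>S. M z u \<longrightarrow> z = x \<or> z = y)"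

definition pair where
  "pair p x y \<longleftrightarrow> (\<exists>u\<in>S. M u p \<and> (\<exists>v\<in>S. M v p \<and> upair u x x \<and> upair v x y \<and> upair p u v))"

definition func where
  "func f a b \<longleftrightarrow>
     (\<forall>p\<in>S. M p f \<longrightarrow> (\<exists>x\<in>S. M x a \<and> (\<exists>y\<in>S. M y b \<and> pair p x y))) \<and>
     (\<forall>x\<in>S. M x a \<longrightarrow> (\<exists>y\<in>S. M y b \<and> (\<exists>p\<in>S. M p f \<and> pair p x y))) \<and>
     (\<forall>x\<in>S. M x a \<longrightarrow> (\<forall>y\<in>S. M y b \<longrightarrow> (\<forall>z\<in>S. M z b \<longrightarrow>
        (\<exists>p\<in>S. M p f \<and> pair p x y) \<and> (\<exists>p\<in>S. M p f \<and> pair p x z) \<longrightarrow> y = z)))"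

definition func_into_class where
  "func_into_class f a B \<longleftrightarrow> (\<exists>b\<in>S. (\<forall>x\<in>S. M x b \<longrightarrow> M1 x B) \<and> func f a b)"

definition class_func where
  "class_func G A B \<longleftrightarrow>
     (\<forall>p\<in>S. M1 p G \<longrightarrow> (\<exists>x\<in>S. M1 x A \<and> (\<exists>y\<in>S. M1 y B \<and> pair p x y))) \<and>
     (\<forall>x\<in>S. M1 x A \<longrightarrow> (\<exists>y\<in>S. \<exists>p\<in>S. pair p x y \<and> M1 p G)) \<and>
     (\<forall>x\<in>S. \<forall>y\<in>S. \<forall>z\<in>S.
        (\<exists>p\<in>S. pair p x y \<and> M1 p G) \<and> (\<exists>p\<in>S. pair p x z \<and> M1 p G) \<longrightarrow> y = z)"

definition bounded where
  "bounded G A B \<longleftrightarrow> (\<forall>s\<in>S. (\<forall>x\<in>S. M x s \<longrightarrow> M1 x A) \<longrightarrow>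
     (\<exists>c\<in>S. (\<forall>y\<in>S. M y c \<longrightarrow> M1 y B) \<and>
       (\<forall>y\<in>S. M y c \<longleftrightarrow> (\<exists>x\<in>S. M x s \<and> (\<exists>p\<in>S. pair p x y \<and> M1 p G))) \<and>
       (\<exists>g\<in>S. (\<forall>p\<in>S. M p g \<longleftrightarrow> M1 p G \<and> (\<exists>x\<in>S. M x s \<and> (\<exists>y\<in>S. pair p x y))) \<and>
         (\<forall>p\<in>S. M p g \<longrightarrow> (\<exists>x\<in>S. M x s \<and> (\<exists>y\<in>S. M y c \<and> pair p x y))))))"

definition bounded_class_func where
  "bounded_class_func G A B \<longleftrightarrow> class_func G A B \<and> bounded G A B"

lemma sat_Is_upair [simp]:
  "sat D E e (Is_upair u x y) \<longleftrightarrow> upair (e Sets u) (e Sets x) (e Sets y)"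
  by (auto simp: Is_upair_def upair_def)

lemma sat_Is_pair [simp]:
  "sat D E e (Is_pair p x y) \<longleftrightarrow> pair (e Sets p) (e Sets x) (e Sets y)"
  by (auto simp: Is_pair_def pair_def)

lemma sat_Pair_in [simp]:
  "sat D E e (Pair_in x y f) \<longleftrightarrow> (\<exists>p\<in>S. M p (e Sets f) \<and> pair p (e Sets x) (e Sets y))"
  by (auto simp: Pair_in_def)

lemma sat_Pair_in_class [simp]:
  "sat D E e (Pair_in_class x y G) \<longleftrightarrow> (\<exists>p\<in>S. pair p (e Sets x) (e Sets y) \<and> M1 p (e Classes G))"
  by (auto simp: Pair_in_class_def)

lemma sat_Function [simp]:
  "sat D E e (Function f a b) \<longleftrightarrow> func (e Sets f) (e Sets a) (e Sets b)"
  by (simp add: Function_def func_def) blast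

lemma sat_Subset_of_class [simp]:
  "sat D E e (a \<subseteq>\<^sup>0 B) \<longleftrightarrow> (\<forall>x\<in>S. M x (e Sets a) \<longrightarrow> M1 x (e Classes B))"
  by (simp add: Subset_of_class_def)

lemma sat_Function_into_class [simp]:
  "sat D E e (Function_into_class f a B) \<longleftrightarrow>
     func_into_class (e Sets f) (e Sets a) (e Classes B)"
  by (simp add: Function_into_class_def func_into_class_def)

lemma sat_Is_class_of [simp]:
  "sat D E e (Is_class_of A \<phi>) \<longleftrightarrow> (\<forall>x\<in>S. M1 x (e Classes A) \<longleftrightarrow> sat D E (bind Sets x e) \<phi>)"
  by (auto simp: Is_class_of_def)

lemma sat_Class_function [simp]:
  "sat D E e (Class_function G A B) \<longleftrightarrow> class_func (e Classes G) (e Classes A) (e Classes B)"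
  by (simp add: Class_function_def class_func_def) blast

lemma sat_Bounded [simp]:
  "sat D E e (Bounded G A B) \<longleftrightarrow> bounded (e Classes G) (e Classes A) (e Classes B)"
  by (simp add: Bounded_def bounded_def, intro ball_cong bex_cong conj_cong imp_cong refl; blast)

lemma sat_Bounded_class_function [simp]:
  "sat D E e (Bounded_class_function G A B) \<longleftrightarrow>
     bounded_class_func (e Classes G) (e Classes A) (e Classes B)"
  by (simp add: Bounded_class_function_def bounded_class_func_def)

lemma pair_inject:
  assumes "pair p x y" "pair p x' y'" "x \<in> S" "y \<in> S" "x' \<in> S" "y' \<in> S"
  shows "x = x' \<and> y = y'"
proof -
  obtain u v where uv: "u \<in> S" "v \<in> S" "upair u x x" "upair v x y" "upair p u v"
    using assms(1) unfolding pair_def by blast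
  obtain u' v' where uv': "u' \<in> S" "v' \<in> S" "upair u' x' x'" "upair v' x' y'" "upair p u' v'"
    using assms(2) unfolding pair_def by blast
  \<comment> \<open>The members of \<open>p\<close> are exactly \<open>u\<close> and
    \<open>v\<close>, and likewise exactly \<open>u'\<close> and \<open>v'\<close>.\<close>
  have p: "(u' = u \<or> u' = v) \<and> (v' = u \<or> v' = v) \<and> (u = u' \<or> u = v') \<and> (v = u' \<or> v = v')"
    using uv(1,2,5) uv'(1,2,5) unfolding upair_def by blast
  \<comment> \<open>Both \<open>u\<close> and \<open>v\<close> contain \<open>x\<close>, and
    \<open>u'\<close> is one of them; but the only member of \<open>u'\<close> is
    \<open>x'\<close>.\<close>
  have x: "x' = x"
    using p uv(3,4) uv'(3,4) assms(3-6) unfolding upair_def by metis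
  then show ?thesis
    using p uv(3,4) uv'(3,4) assms(3-6) unfolding upair_def by metis
qed

section \<open>Set functions versus bounded class functions\<close>

lemma graph_of_function:
  assumes S: "a \<in> S" "f \<in> S" and C: "A \<in> C" "B \<in> C"
    and A: "\<And>x. x \<in> S \<Longrightarrow> M1 x A \<longleftrightarrow> M x a" and f: "func_into_class f a B"
  shows "\<exists>G\<in>C. (\<forall>x\<in>S. M1 x G \<longleftrightarrow> M x f) \<and> class_func G A B \<and> bounded G A B"
proof -
  obtain b where b: "b \<in> S" "\<And>x. x \<in> S \<Longrightarrow> M x b \<Longrightarrow> M1 x B" and func: "func f a b"
    using f unfolding func_into_class_def by blast
  have "bind Sets f e\<^sub>0 t n \<in> D t" for t n by (intro bind_in_D S e\<^sub>0)
  from class_comprehension[where \<phi> = "0 \<in>\<^sup>0 1" and e = "bind Sets f e\<^sub>0", OF _ this]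
  obtain G where G: "G \<in> C" "\<And>x. x \<in> S \<Longrightarrow> M1 x G \<longleftrightarrow> M x f"
    by auto
  have rel: "\<exists>x\<in>S. M x a \<and> (\<exists>y\<in>S. M y b \<and> pair p x y)" if "p \<in> S" "M p f" for p
    using func that unfolding func_def by blast
  \<comment> \<open>In \<open>func\<close> single-valuedness concerns arguments in \<open>a\<close>
    and values in \<open>b\<close>, in \<open>class_func\<close> all sets. Injectivity of pairs
    bridges the gap by locating the coordinates of members of \<open>f\<close>.\<close>
  have rel': "M x a \<and> M y b" if "p \<in> S" "M p f" "pair p x y" "x \<in> S" "y \<in> S" for p x y
    using rel[OF that(1,2)] pair_inject that by blast
  have class_func: "class_func G A B"
    unfolding class_func_def
  proof (intro conjI ballI impI)
    fix p assume "p \<in> S" "M1 p G"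
    then show "\<exists>x\<in>S. M1 x A \<and> (\<exists>y\<in>S. M1 y B \<and> pair p x y)"
      using rel[of p] G A b(2) by blast
  next
    fix x assume "x \<in> S" "M1 x A"
    then show "\<exists>y\<in>S. \<exists>p\<in>S. pair p x y \<and> M1 p G"
      using func G A unfolding func_def by meson
  next
    fix x y z
    assume xyz: "x \<in> S" "y \<in> S" "z \<in> S"
      and "(\<exists>p\<in>S. pair p x y \<and> M1 p G) \<and> (\<exists>p\<in>S. pair p x z \<and> M1 p G)"
    then obtain p q where "p \<in> S" "M p f" "pair p x y" "q \<in> S" "M q f" "pair q x z"
      using G(2) by blast
    moreover from this have "M x a" "M y b" "M z b" using rel' xyz by blast+
    ultimately show "y = z" using func xyz unfolding func_def by blast
  qed
  have image: "\<exists>c\<in>S. (\<forall>y\<in>S. M y c \<longrightarrow> M1 y B) \<and>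
         (\<forall>y\<in>S. M y c \<longleftrightarrow> (\<exists>x\<in>S. M x s \<and> (\<exists>p\<in>S. pair p x y \<and> M1 p G))) \<and>
         (\<exists>g\<in>S. (\<forall>p\<in>S. M p g \<longleftrightarrow> M1 p G \<and> (\<exists>x\<in>S. M x s \<and> (\<exists>y\<in>S. pair p x y))) \<and>
           (\<forall>p\<in>S. M p g \<longrightarrow> (\<exists>x\<in>S. M x s \<and> (\<exists>y\<in>S. M y c \<and> pair p x y))))"
    if s: "s \<in> S" for s
  proof -
    \<comment> \<open>Set variables: 0 = \<open>s\<close>, 1 = \<open>f\<close>, 2 =
      \<open>b\<close>; inside a separation formula each moves up by one, with the candidate member
      at 0.\<close>
    let ?e = "bind Sets s (bind Sets f (bind Sets b e\<^sub>0))"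
    have e: "?e t n \<in> D t" for t n by (intro bind_in_D S b s e\<^sub>0)
    \<comment> \<open>The image is separated from \<open>b\<close>. The formula speaks of the set
      \<open>f\<close> in place of the class \<open>G\<close>, since bounded formulas admit no class
      parameters.\<close>
    have "bounded_fm (BEx 1 (Pair_in 0 1 3))" by (intro bounded_fm_BEx bounded_fm_Pair_in)
    from separation[where e = ?e and a = 2, OF this e] obtain c where c: "c \<in> S"
      "\<And>y. y \<in> S \<Longrightarrow> M y c \<longleftrightarrow> M y b \<and> (\<exists>x\<in>S. M x s \<and> (\<exists>p\<in>S. M p f \<and> pair p x y))"
      by auto
    \<comment> \<open>The restricted graph is separated from \<open>f\<close>; bounding the second
      coordinate by \<open>b\<close> makes the formula bounded and changes nothing by
      \<open>rel'\<close>.\<close>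
    have "bounded_fm (BEx 1 (BEx 4 (Is_pair 2 1 0)))" by (intro bounded_fm_BEx bounded_fm_Is_pair)
    from separation[where e = ?e and a = 1, OF this e] obtain g where g: "g \<in> S"
      "\<And>p. p \<in> S \<Longrightarrow> M p g \<longleftrightarrow> M p f \<and> (\<exists>x\<in>S. M x s \<and> (\<exists>y\<in>S. M y b \<and> pair p x y))"
      by auto
    show ?thesis
    proof (rule bexI[OF _ c(1)], intro conjI ballI bexI[OF _ g(1)])
      fix y assume y: "y \<in> S"
      show "M y c \<longrightarrow> M1 y B" using c(2) b(2) y by blast
      show "M y c \<longleftrightarrow> (\<exists>x\<in>S. M x s \<and> (\<exists>p\<in>S. pair p x y \<and> M1 p G))"
        unfolding c(2)[OF y] using G(2) rel' y by blast
    next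
      fix p assume p: "p \<in> S"
      show "M p g \<longleftrightarrow> M1 p G \<and> (\<exists>x\<in>S. M x s \<and> (\<exists>y\<in>S. pair p x y))"
        unfolding g(2)[OF p] using G(2) rel' p by blast
      show "M p g \<longrightarrow> (\<exists>x\<in>S. M x s \<and> (\<exists>y\<in>S. M y c \<and> pair p x y))"
        using g(2)[OF p] c(2) p by blast
    qed
  qed
  have "bounded G A B" unfolding bounded_def by (intro ballI impI image)
  with class_func G show ?thesis by blast
qed

lemma function_of_graph:
  assumes S: "a \<in> S" and A: "\<And>x. x \<in> S \<Longrightarrow> M1 x A \<longleftrightarrow> M x a"
    and G: "class_func G A B" "bounded G A B"
  shows "\<exists>f\<in>S. func_into_class f a B \<and> (\<forall>x\<in>S. M1 x G \<longleftrightarrow> M x f)"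
proof -
  have G1: "\<exists>x\<in>S. M x a \<and> (\<exists>y\<in>S. M1 y B \<and> pair p x y)" if "p \<in> S" "M1 p G" for p
    using G that A unfolding class_func_def by blast
  have G2: "\<exists>y\<in>S. \<exists>p\<in>S. pair p x y \<and> M1 p G" if "x \<in> S" "M x a" for x
    using G that A unfolding class_func_def by blast
  have G3: "y = z"
    if "x \<in> S" "y \<in> S" "z \<in> S" "p \<in> S" "pair p x y" "M1 p G" "q \<in> S" "pair q x z" "M1 q G"
    for x y z p q
    using G that unfolding class_func_def by blast
  have "\<forall>x\<in>S. M x a \<longrightarrow> M1 x A" using A by blast
  \<comment> \<open>Boundedness at \<open>a\<close> itself: the image \<open>c\<close> becomes the
    codomain and the restricted graph becomes the set function \<open>f\<close>.\<close>
  from bspec[OF G(2)[unfolded bounded_def] S, THEN mp, OF this]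
  obtain c f where c: "c \<in> S" "\<forall>y\<in>S. M y c \<longrightarrow> M1 y B"
      "\<forall>y\<in>S. M y c \<longleftrightarrow> (\<exists>x\<in>S. M x a \<and> (\<exists>p\<in>S. pair p x y \<and> M1 p G))"
    and f: "f \<in> S" "\<forall>p\<in>S. M p f \<longleftrightarrow> M1 p G \<and> (\<exists>x\<in>S. M x a \<and> (\<exists>y\<in>S. pair p x y))"
      "\<forall>p\<in>S. M p f \<longrightarrow> (\<exists>x\<in>S. M x a \<and> (\<exists>y\<in>S. M y c \<and> pair p x y))"
    by (elim bexE conjE) (rule that)
  \<comment> \<open>Restricting to \<open>a\<close> loses no member of \<open>G\<close>, because
    first coordinates of its members lie in \<open>A\<close> and so in \<open>a\<close>.\<close>
  have fG: "M1 p G \<longleftrightarrow> M p f" if "p \<in> S" for p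
    using f(2) G1 that by blast
  have "func f a c"
    unfolding func_def
  proof (intro conjI ballI impI)
    fix x assume "x \<in> S" "M x a"
    then show "\<exists>y\<in>S. M y c \<and> (\<exists>p\<in>S. M p f \<and> pair p x y)"
      using G2[of x] c(3) fG by meson
  qed (use f(3) G3 fG in blast)+
  then show ?thesis using c f(1) fG unfolding func_into_class_def by blast
qed

text \<open>The theorem evaluated in a model. Membership in the class \<open>F\<close> is already
  replaced by its defining formula, which separates the existence of \<open>F\<close> from the
  correspondence with class functions.\<close>

lemma function_classes:
  assumes S: "a \<in> S" and C: "B \<in> C"
  shows "(\<exists>F\<in>C. \<forall>f\<in>S. M1 f F \<longleftrightarrow> func_into_class f a B) \<and>
    (\<exists>A\<in>C. (\<forall>x\<in>S. M1 x A \<longleftrightarrow> M x a) \<and>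
      (\<forall>f\<in>S. func_into_class f a B \<longrightarrow>
        (\<exists>G\<in>C. (\<forall>x\<in>S. M1 x G \<longleftrightarrow> M x f) \<and> bounded_class_func G A B)) \<and>
      (\<forall>G\<in>C. bounded_class_func G A B \<longrightarrow>
        (\<exists>f\<in>S. func_into_class f a B \<and> (\<forall>x\<in>S. M1 x G \<longleftrightarrow> M x f))))"
proof -
  let ?e = "bind Classes B (bind Sets a e\<^sub>0)"
  have e: "?e t n \<in> D t" for t n by (intro bind_in_D S C e\<^sub>0)
  \<comment> \<open>This is what makes the formula define a class: \<open>B\<close> enters only as a
    parameter, and all quantifiers range over sets.\<close>
  have "quantifies_over_sets (Function_into_class 0 1 0)"
    by (simp add: Function_into_class_def Subset_of_class_def Function_def Pair_in_def Is_pair_def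
        Is_upair_def)
  from class_comprehension[where e = ?e, OF this e]
  obtain F where F: "F \<in> C" "\<And>f. f \<in> S \<Longrightarrow> M1 f F \<longleftrightarrow> func_into_class f a B"
    by auto
  from class_comprehension[where e = ?e and \<phi> = "0 \<in>\<^sup>0 1", OF _ e]
  obtain A where A: "A \<in> C" "\<And>x. x \<in> S \<Longrightarrow> M1 x A \<longleftrightarrow> M x a"
    by auto
  have "\<exists>G\<in>C. (\<forall>x\<in>S. M1 x G \<longleftrightarrow> M x f) \<and> bounded_class_func G A B"
    if "f \<in> S" "func_into_class f a B" for f
    unfolding bounded_class_func_def using that by (intro graph_of_function[OF S _ A(1) C A(2)])
  moreover have "\<exists>f\<in>S. func_into_class f a B \<and> (\<forall>x\<in>S. M1 x G \<longleftrightarrow> M x f)"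
    if "bounded_class_func G A B" for G
    using that unfolding bounded_class_func_def by (intro function_of_graph[OF S A(2)]) auto
  ultimately show ?thesis using F A by blast
qed

end

theorem theorem2p5:
  shows "MTT \<turnstile>
    \<comment> \<open>for every set a and class B there is a class E\<close>
    Forall Sets (Forall Classes (Exists Classes (
      \<comment> \<open>sets: 0 = a; classes: 0 = E, 1 = B; E is the class of all f satisfying the formula\<close>
      Is_class_of 0 (Function_into_class 0 1 1)
      \<^bold>\<and>
      \<comment> \<open>classes: 0 = A = {x | x in a}, 1 = E, 2 = B\<close>
      Exists Classes (
        Is_class_of 0 (0 \<in>\<^sup>0 1)
        \<^bold>\<and>
        \<comment> \<open>every f in E has as its graph a bounded class function G from A to B;
            sets: 0 = f, 1 = a; classes: 0 = G, 1 = A, 2 = E, 3 = B\<close>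
        Forall Sets (0 \<in>\<^sup>1 1 \<^bold>\<longrightarrow>
          Exists Classes (Is_class_of 0 (0 \<in>\<^sup>0 1) \<^bold>\<and> Bounded_class_function 0 1 3))
        \<^bold>\<and>
        \<comment> \<open>and every bounded class function G from A to B is the graph of some f in E\<close>
        Forall Classes (Bounded_class_function 0 1 3 \<^bold>\<longrightarrow>
          Exists Sets (0 \<in>\<^sup>1 2 \<^bold>\<and> Is_class_of 0 (0 \<in>\<^sup>0 1)))))))"
proof -
  interpret renaming_closed set_class_comprehension
    by (rule renaming_closed_set_class_comprehension)
  have "set_class_comprehension \<subseteq> MTT"
    unfolding set_class_comprehension_def MTT_def MAC_def by blast
  then have MTT: "MTT \<turnstile> \<phi>" if "set_class_comprehension \<turnstile> \<phi>" for \<phi>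
    using that derivable_mono unfolding provable_def by blast
  show ?thesis
  proof (rule MTT[OF completeness], goal_cases)
    case (1 D E e)
    interpret comprehension_model D E e by unfold_locales (fact 1)+
    show ?case using function_classes by simp
  qed
qed

end
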